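(* Let $\mathcal{G}=(G^0,\mathcal{G}^1,r,s)$ be an ultragraph and let $\pi:C^*(\mathcal{G})\to B(H)$ be a representation. Suppose that $H_{r(e)}=\bigoplus_{v\in r(e)}H_v$ for each $e\in\mathcal{G}^1$. If there exists $n\ge1$ such that $X_1,\dots,X_n\ne\emptyset$ and $\Big(\bigcup_{e\in\mathcal{G}^1}r(e)\Big)\cup s(\mathcal{G}^1)=\bigcup_{i=1}^n(\overline{X_i}\cup I_i)$, then $\pi$ is permutative.
   Context: Standing conventions: C*-algebras are separable; all representations are on separable infinite-dimensional Hilbert spaces; a representation is a $*$-homomorphism into $B(H)$ (not assumed nondegenerate). Ultragraph: $\mathcal{G}=(G^0,\mathcal{G}^1,r,s)$ consists of countable sets $G^0$ (vertices) and $\mathcal{G}^1$ (edges), a map $s:\mathcal{G}^1\to G^0$ and a map $r:\mathcal{G}^1\to P(G^0)\setminus\{\emptyset\}$, $P(G^0)$ being the power set. $\mathcal{G}^0$ denotes the smallest subset of $P(G^0)$ containing $\{v\}$ for all $v\in G^0$ and $r(e)$ for all $e\in\mathcal{G}^1$, and closed under finite unions and nonempty finite intersections (intersections of nonempty finite families); $\emptyset$ is regarded as an element of $\mathcal{G}^0$. A vertex $v$ is identified with $\{v\}$. $C^*(\mathcal{G})$ is the universal C*-algebra generated by partial isometries $\{s_e:e\in\mathcal{G}^1\}$ with mutually orthogonal ranges and projections $\{p_A:A\in\mathcal{G}^0\}$ such that: (1) $p_\emptyset=0$, $p_Ap_B=p_{A\cap B}$, $p_{A\cup B}=p_A+p_B-p_{A\cap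 B}$; (2) $s_e^*s_e=p_{r(e)}$; (3) $s_es_e^*\le p_{s(e)}$; (4) $p_v=\sum_{s(e)=v}s_es_e^*$ whenever $0<|s^{-1}(v)|<\infty$. Permutative representation: given $\pi:C^*(\mathcal{G})\to B(H)$, let $H_e=\pi(s_es_e^* )(H)$ for $e\in\mathcal{G}^1$ and $H_A=\pi(p_A)(H)$ for $A\in\mathcal{G}^0$. $\pi$ is permutative if there exist orthonormal bases $B$ of $H$, $B_v$ of $H_v$ ($v\in G^0$), $B_{r(e)}$ of $H_{r(e)}$ and $B_e$ of $H_e$ ($e\in\mathcal{G}^1$) such that: (1) $B_{r(e)}\subset B$ for all $e\in\mathcal{G}^1$ and $B_v\subseteq B$ for all $v\in G^0$; (2) $B_v\subset B_{r(e)}$ whenever $v\in r(e)$; (3) $B_v\supset\bigcup_{e\in s^{-1}(v)}B_e$ for all $v\in G^0$; (4) $\pi(s_e)(B_{r(e)})=B_e$ for all $e\in\mathcal{G}^1$. Extreme and isolated vertices: an extreme vertex of an ultragraph $\mathcal{G}$ is a set $A$ such that either $A=r(e)$ for some edge $e$, and $A$ is disjoint from $\bigcup_{f\ne e}r(f)$ and from $s(\mathcal{G}^1)$; or $A=\{s(e)\}$ for some edge $e$, and $A$ is disjoint from $s(\mathcal{G}^1\setminus\{e\})$ and from $\bigcup_{f\in\mathcal{G}^1}r(f)$. The edge $e$ is the extreme edge of $A$. An isolated vertex is a vertex not in $\big(\bigcup_{e}r(e)\big)\cup s(\mathcal{G}^1)$. Let $I_0$ be the set of isolated vertices of $\mathcal{G}$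 and $\mathbb{G}_0=(G^0\setminus I_0,\mathcal{G}^1,r,s)$. Inductively, for $n\ge0$ (as long as the sets of extreme vertices are nonempty), let $X_{n+1}$ be the set of extreme vertices of $\mathbb{G}_n$, $Y_{n+1}$ the set of extreme edges of $\mathbb{G}_n$, $\overline{X_{n+1}}=\bigcup_{A\in X_{n+1}}A$, $I_{n+1}$ the set of isolated vertices of the ultragraph $\big(G^0\setminus(I_0\cup\dots\cup I_n\cup\overline{X_1}\cup\dots\cup\overline{X_{n+1}}),\ \mathcal{G}^1\setminus(Y_1\cup\dots\cup Y_{n+1}),r,s\big)$, and $\mathbb{G}_{n+1}=\big(G^0\setminus(I_0\cup\dots\cup I_{n+1}\cup\overline{X_1}\cup\dots\cup\overline{X_{n+1}}),\ \mathcal{G}^1\setminus(Y_1\cup\dots\cup Y_{n+1}),r,s\big)$. *)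

theory Defs
  imports "HOL-Analysis.Analysis" "HOL-Algebra.Module"
begin

section \<open>Complex Hilbert spaces\<close>

text \<open>Inner products are linear in the first argument.\<close>

class complex_inner = real_normed_vector +
  fixes scaleC :: "complex \<Rightarrow> 'a \<Rightarrow> 'a"  (infixr "*\<^sub>C" 75)
    and cinner :: "'a \<Rightarrow> 'a \<Rightarrow> complex"
  assumes scaleC_add_right: "c *\<^sub>C (x + y) = c *\<^sub>C x + c *\<^sub>C y"
    and scaleC_add_left: "(c + d) *\<^sub>C x = c *\<^sub>C x + d *\<^sub>C x"
    and scaleC_scaleC: "c *\<^sub>C (d *\<^sub>C x) = (c * d) *\<^sub>C x"
    and scaleC_one: "1 *\<^sub>C x = x"
    and scaleR_scaleC: "scaleR t x = complex_of_real t *\<^sub>C x"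
    and cinner_commute: "cinner x y = cnj (cinner y x)"
    and cinner_add_left: "cinner (x + y) z = cinner x z + cinner y z"
    and cinner_scaleC_left: "cinner (c *\<^sub>C x) y = c * cinner x y"
    and cinner_norm: "cinner x x = complex_of_real ((norm x)\<^sup>2)"

class chilbert_space = complex_inner + complete_space

global_interpretation complex_vector: vector_space
  "scaleC :: complex \<Rightarrow> 'a \<Rightarrow> 'a::complex_inner"
  defines cspan = complex_vector.span
  by unfold_locales (simp_all add: scaleC_add_right scaleC_add_left scaleC_scaleC scaleC_one)

definition orthonormal_basis :: "'h::chilbert_space set \<Rightarrow> 'h set \<Rightarrow> bool" where
  "orthonormal_basis M B \<longleftrightarrow>
     (\<forall>x\<in>B. norm x = 1) \<and> pairwise (\<lambda>x y. cinner x y = 0) B \<and> closure (cspan B) = M"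

text \<open>Internal Hilbert space direct sum of a family of closed subspaces.\<close>

definition hilbert_direct_sum :: "'i set \<Rightarrow> ('i \<Rightarrow> 'h::chilbert_space set) \<Rightarrow> 'h set \<Rightarrow> bool" where
  "hilbert_direct_sum I M N \<longleftrightarrow>
     pairwise (\<lambda>i j. \<forall>x\<in>M i. \<forall>y\<in>M j. cinner x y = 0) I \<and>
     N = closure (cspan (\<Union>i\<in>I. M i))"

section \<open>C*-algebras\<close>

text \<open>
  C*-algebras are given with an explicit carrier, so that one can quantify over them in the
  universal property below. They need not be unital: the field \<open>one\<close>, inherited from the
  record \<open>ring\<close>, is never used.
\<close>

record 'a cstar = "(complex, 'a) module" +
  star :: "'a \<Rightarrow> 'a"
  cnorm :: "'a \<Rightarrow> real"

definition cdist :: "'a cstar \<Rightarrow> 'a \<Rightarrow> 'a \<Rightarrow> real" where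
  "cdist A x y = cnorm A (x \<ominus>\<^bsub>A\<^esub> y)"

locale cstar_algebra = abelian_group A for A :: "'a cstar" (structure) +
  assumes smult_closed: "x \<in> carrier A \<Longrightarrow> c \<odot> x \<in> carrier A"
    and smult_add_right: "x \<in> carrier A \<Longrightarrow> y \<in> carrier A \<Longrightarrow> c \<odot> (x \<oplus> y) = c \<odot> x \<oplus> c \<odot> y"
    and smult_add_left: "x \<in> carrier A \<Longrightarrow> (c + d) \<odot> x = c \<odot> x \<oplus> d \<odot> x"
    and smult_smult: "x \<in> carrier A \<Longrightarrow> c \<odot> (d \<odot> x) = (c * d) \<odot> x"
    and smult_one: "x \<in> carrier A \<Longrightarrow> 1 \<odot> x = x"
    and mult_closed: "x \<in> carrier A \<Longrightarrow> y \<in> carrier A \<Longrightarrow> x \<otimes> y \<in> carrier A"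
    and mult_assoc: "x \<in> carrier A \<Longrightarrow> y \<in> carrier A \<Longrightarrow> z \<in> carrier A \<Longrightarrow>
          (x \<otimes> y) \<otimes> z = x \<otimes> (y \<otimes> z)"
    and mult_add_left: "x \<in> carrier A \<Longrightarrow> y \<in> carrier A \<Longrightarrow> z \<in> carrier A \<Longrightarrow>
          (x \<oplus> y) \<otimes> z = x \<otimes> z \<oplus> y \<otimes> z"
    and mult_add_right: "x \<in> carrier A \<Longrightarrow> y \<in> carrier A \<Longrightarrow> z \<in> carrier A \<Longrightarrow>
          x \<otimes> (y \<oplus> z) = x \<otimes> y \<oplus> x \<otimes> z"
    and smult_mult_left: "x \<in> carrier A \<Longrightarrow> y \<in> carrier A \<Longrightarrow> (c \<odot> x) \<otimes> y = c \<odot> (x \<otimes> y)"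
    and smult_mult_right: "x \<in> carrier A \<Longrightarrow> y \<in> carrier A \<Longrightarrow> x \<otimes> (c \<odot> y) = c \<odot> (x \<otimes> y)"
    and star_closed: "x \<in> carrier A \<Longrightarrow> star A x \<in> carrier A"
    and star_star: "x \<in> carrier A \<Longrightarrow> star A (star A x) = x"
    and star_add: "x \<in> carrier A \<Longrightarrow> y \<in> carrier A \<Longrightarrow> star A (x \<oplus> y) = star A x \<oplus> star A y"
    and star_smult: "x \<in> carrier A \<Longrightarrow> star A (c \<odot> x) = cnj c \<odot> star A x"
    and star_mult: "x \<in> carrier A \<Longrightarrow> y \<in> carrier A \<Longrightarrow> star A (x \<otimes> y) = star A y \<otimes> star A x"
    and cnorm_nonneg: "x \<in> carrier A \<Longrightarrow> 0 \<le> cnorm A x"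
    and cnorm_eq_0: "x \<in> carrier A \<Longrightarrow> cnorm A x = 0 \<longleftrightarrow> x = \<zero>"
    and cnorm_smult: "x \<in> carrier A \<Longrightarrow> cnorm A (c \<odot> x) = cmod c * cnorm A x"
    and cnorm_triangle: "x \<in> carrier A \<Longrightarrow> y \<in> carrier A \<Longrightarrow>
          cnorm A (x \<oplus> y) \<le> cnorm A x + cnorm A y"
    and cnorm_mult: "x \<in> carrier A \<Longrightarrow> y \<in> carrier A \<Longrightarrow>
          cnorm A (x \<otimes> y) \<le> cnorm A x * cnorm A y"
    and cstar_identity: "x \<in> carrier A \<Longrightarrow> cnorm A (star A x \<otimes> x) = (cnorm A x)\<^sup>2"
    and complete: "Metric_space.mcomplete (carrier A) (cdist A)"

definition star_hom :: "'a cstar \<Rightarrow> 'b cstar \<Rightarrow> ('a \<Rightarrow> 'b) set" where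
  "star_hom A B = {\<phi>. \<phi> \<in> carrier A \<rightarrow> carrier B \<and>
     (\<forall>x\<in>carrier A. \<forall>y\<in>carrier A. \<phi> (x \<oplus>\<^bsub>A\<^esub> y) = \<phi> x \<oplus>\<^bsub>B\<^esub> \<phi> y) \<and>
     (\<forall>c. \<forall>x\<in>carrier A. \<phi> (c \<odot>\<^bsub>A\<^esub> x) = c \<odot>\<^bsub>B\<^esub> \<phi> x) \<and>
     (\<forall>x\<in>carrier A. \<forall>y\<in>carrier A. \<phi> (x \<otimes>\<^bsub>A\<^esub> y) = \<phi> x \<otimes>\<^bsub>B\<^esub> \<phi> y) \<and>
     (\<forall>x\<in>carrier A. \<phi> (star A x) = star B (\<phi> x))}"

definition cstar_subalgebra :: "'a cstar \<Rightarrow> 'a set \<Rightarrow> bool" where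
  "cstar_subalgebra A S \<longleftrightarrow>
     closedin (Metric_space.mtopology (carrier A) (cdist A)) S \<and>
     \<zero>\<^bsub>A\<^esub> \<in> S \<and>
     (\<forall>x\<in>S. \<forall>y\<in>S. x \<oplus>\<^bsub>A\<^esub> y \<in> S \<and> x \<otimes>\<^bsub>A\<^esub> y \<in> S) \<and>
     (\<forall>c. \<forall>x\<in>S. c \<odot>\<^bsub>A\<^esub> x \<in> S) \<and>
     (\<forall>x\<in>S. star A x \<in> S)"

definition cstar_generated_by :: "'a cstar \<Rightarrow> 'a set \<Rightarrow> bool" where
  "cstar_generated_by A X \<longleftrightarrow>
     X \<subseteq> carrier A \<and> (\<forall>S. cstar_subalgebra A S \<and> X \<subseteq> S \<longrightarrow> S = carrier A)"

text \<open>The positive elements of a C*-algebra are those of the form \<open>z* z\<close>.\<close>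

definition cstar_le :: "'a cstar \<Rightarrow> 'a \<Rightarrow> 'a \<Rightarrow> bool" where
  "cstar_le A x y \<longleftrightarrow> (\<exists>z\<in>carrier A. y \<ominus>\<^bsub>A\<^esub> x = star A z \<otimes>\<^bsub>A\<^esub> z)"

definition projection :: "'a cstar \<Rightarrow> 'a \<Rightarrow> bool" where
  "projection A q \<longleftrightarrow> q \<in> carrier A \<and> star A q = q \<and> q \<otimes>\<^bsub>A\<^esub> q = q"

definition partial_isometry :: "'a cstar \<Rightarrow> 'a \<Rightarrow> bool" where
  "partial_isometry A u \<longleftrightarrow> u \<in> carrier A \<and> u \<otimes>\<^bsub>A\<^esub> star A u \<otimes>\<^bsub>A\<^esub> u = u"

definition adjoint_op ::
    "('h::chilbert_space \<Rightarrow>\<^sub>L 'h) \<Rightarrow> ('h \<Rightarrow>\<^sub>L 'h)" where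
  "adjoint_op T = (THE S. \<forall>x y. cinner (blinfun_apply T x) y = cinner x (blinfun_apply S y))"

text \<open>
  The library type of bounded operators only asks for real linearity; \<open>B(H)\<close> consists of the
  complex linear ones.
\<close>

definition bounded_operators :: "('h::chilbert_space \<Rightarrow>\<^sub>L 'h) cstar" where
  "bounded_operators =
     \<lparr> carrier = {T. \<forall>c x. blinfun_apply T (c *\<^sub>C x) = c *\<^sub>C blinfun_apply T x},
       mult = (\<lambda>S T. S o\<^sub>L T),
       one = id_blinfun,
       zero = 0,
       add = (+),
       smult = (\<lambda>c T. Blinfun (\<lambda>x. c *\<^sub>C blinfun_apply T x)),
       star = adjoint_op,
       cnorm = norm \<rparr>"

section \<open>Ultragraphs\<close>

record ('v, 'e) ugraph =
  verts :: "'v set"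
  edges :: "'e set"
  rng :: "'e \<Rightarrow> 'v set"
  src :: "'e \<Rightarrow> 'v"

locale ultragraph =
  fixes G :: "('v, 'e) ugraph"
  assumes countable_verts: "countable (verts G)"
    and countable_edges: "countable (edges G)"
    and src_closed: "e \<in> edges G \<Longrightarrow> src G e \<in> verts G"
    and rng_closed: "e \<in> edges G \<Longrightarrow> rng G e \<subseteq> verts G"
    and rng_nonempty: "e \<in> edges G \<Longrightarrow> rng G e \<noteq> {}"

text \<open>The collection \<open>\<G>\<^sup>0\<close> of vertex sets.\<close>

inductive_set vsets :: "('v, 'e) ugraph \<Rightarrow> 'v set set" for G :: "('v, 'e) ugraph" where
  empty: "{} \<in> vsets G"
| vertex: "v \<in> verts G \<Longrightarrow> {v} \<in> vsets G"
| range: "e \<in> edges G \<Longrightarrow> rng G e \<in> vsets G"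
| union: "A \<in> vsets G \<Longrightarrow> B \<in> vsets G \<Longrightarrow> A \<union> B \<in> vsets G"
| inter: "A \<in> vsets G \<Longrightarrow> B \<in> vsets G \<Longrightarrow> A \<inter> B \<in> vsets G"

definition ultragraph_family ::
    "('v, 'e) ugraph \<Rightarrow> 'a cstar \<Rightarrow> ('e \<Rightarrow> 'a) \<Rightarrow> ('v set \<Rightarrow> 'a) \<Rightarrow> bool" where
  "ultragraph_family G A s p \<longleftrightarrow>
     (\<forall>e\<in>edges G. partial_isometry A (s e)) \<and>
     (\<forall>e\<in>edges G. \<forall>f\<in>edges G. e \<noteq> f \<longrightarrow>
        (s e \<otimes>\<^bsub>A\<^esub> star A (s e)) \<otimes>\<^bsub>A\<^esub> (s f \<otimes>\<^bsub>A\<^esub> star A (s f)) = \<zero>\<^bsub>A\<^esub>) \<and>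
     (\<forall>X\<in>vsets G. projection A (p X)) \<and>
     p {} = \<zero>\<^bsub>A\<^esub> \<and>
     (\<forall>X\<in>vsets G. \<forall>Y\<in>vsets G. p X \<otimes>\<^bsub>A\<^esub> p Y = p (X \<inter> Y)) \<and>
     (\<forall>X\<in>vsets G. \<forall>Y\<in>vsets G. p (X \<union> Y) = p X \<oplus>\<^bsub>A\<^esub> p Y \<ominus>\<^bsub>A\<^esub> p (X \<inter> Y)) \<and>
     (\<forall>e\<in>edges G. star A (s e) \<otimes>\<^bsub>A\<^esub> s e = p (rng G e)) \<and>
     (\<forall>e\<in>edges G. cstar_le A (s e \<otimes>\<^bsub>A\<^esub> star A (s e)) (p {src G e})) \<and>
     (\<forall>v\<in>verts G. finite {e\<in>edges G. src G e = v} \<and> {e\<in>edges G. src G e = v} \<noteq> {} \<longrightarrow>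
        p {v} = (\<Oplus>\<^bsub>A\<^esub>e\<in>{e\<in>edges G. src G e = v}. s e \<otimes>\<^bsub>A\<^esub> star A (s e)))"

text \<open>
  \<open>A\<close>, with generators \<open>s\<close> and \<open>p\<close>, is the universal C*-algebra of \<open>G\<close>. HOL cannot quantify over
  the C*-algebras on all types at once, but C*-algebras with carrier in \<open>real\<close> suffice: the
  C*-subalgebra generated by a \<open>G\<close>-family in any C*-algebra is separable, since \<open>G\<close> is countable,
  so it has at most continuum many elements and is isomorphic to one whose carrier is a set of
  reals. Uniqueness of \<open>\<phi>\<close> on \<open>carrier A\<close> follows from generation.
\<close>

definition universal_ultragraph_algebra ::
    "('v, 'e) ugraph \<Rightarrow> 'a cstar \<Rightarrow> ('e \<Rightarrow> 'a) \<Rightarrow> ('v set \<Rightarrow> 'a) \<Rightarrow> bool" where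
  "universal_ultragraph_algebra G A s p \<longleftrightarrow>
     cstar_algebra A \<and>
     ultragraph_family G A s p \<and>
     cstar_generated_by A (s ` edges G \<union> p ` vsets G) \<and>
     (\<forall>(B :: real cstar) S P. cstar_algebra B \<and> ultragraph_family G B S P \<longrightarrow>
        (\<exists>\<phi>\<in>star_hom A B. (\<forall>e\<in>edges G. \<phi> (s e) = S e) \<and> (\<forall>X\<in>vsets G. \<phi> (p X) = P X)))"

section \<open>Permutative representations\<close>

definition edge_space ::
    "'a cstar \<Rightarrow> ('e \<Rightarrow> 'a) \<Rightarrow> ('a \<Rightarrow> ('h::chilbert_space \<Rightarrow>\<^sub>L 'h)) \<Rightarrow> 'e \<Rightarrow> 'h set" where
  "edge_space A s \<pi> e = range (blinfun_apply (\<pi> (s e \<otimes>\<^bsub>A\<^esub> star A (s e))))"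

definition vset_space ::
    "('v set \<Rightarrow> 'a) \<Rightarrow> ('a \<Rightarrow> ('h::chilbert_space \<Rightarrow>\<^sub>L 'h)) \<Rightarrow> 'v set \<Rightarrow> 'h set" where
  "vset_space p \<pi> X = range (blinfun_apply (\<pi> (p X)))"

text \<open>The bases \<open>B\<^bsub>r(e)\<^esub>\<close> are indexed by the sets \<open>r(e)\<close>, not by the edges \<open>e\<close>.\<close>

definition permutative ::
    "('v, 'e) ugraph \<Rightarrow> 'a cstar \<Rightarrow> ('e \<Rightarrow> 'a) \<Rightarrow> ('v set \<Rightarrow> 'a) \<Rightarrow>
     ('a \<Rightarrow> ('h::chilbert_space \<Rightarrow>\<^sub>L 'h)) \<Rightarrow> bool" where
  "permutative G A s p \<pi> \<longleftrightarrow>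
     (\<exists>(B :: 'h set) (BV :: 'v \<Rightarrow> 'h set) (BR :: 'v set \<Rightarrow> 'h set) (BE :: 'e \<Rightarrow> 'h set).
        orthonormal_basis UNIV B \<and>
        (\<forall>v\<in>verts G. orthonormal_basis (vset_space p \<pi> {v}) (BV v)) \<and>
        (\<forall>e\<in>edges G. orthonormal_basis (vset_space p \<pi> (rng G e)) (BR (rng G e))) \<and>
        (\<forall>e\<in>edges G. orthonormal_basis (edge_space A s \<pi> e) (BE e)) \<and>
        (\<forall>e\<in>edges G. BR (rng G e) \<subseteq> B) \<and>
        (\<forall>v\<in>verts G. BV v \<subseteq> B) \<and>
        (\<forall>e\<in>edges G. \<forall>v\<in>rng G e. BV v \<subseteq> BR (rng G e)) \<and>
        (\<forall>v\<in>verts G. (\<Union>e\<in>{e\<in>edges G. src G e = v}. BE e) \<subseteq> BV v) \<and>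
        (\<forall>e\<in>edges G. blinfun_apply (\<pi> (s e)) ` BR (rng G e) = BE e))"

section \<open>Extreme and isolated vertices\<close>

definition extreme_edge_of :: "('v, 'e) ugraph \<Rightarrow> 'v set \<Rightarrow> 'e \<Rightarrow> bool" where
  "extreme_edge_of G A e \<longleftrightarrow> e \<in> edges G \<and>
     (A = rng G e \<and> A \<inter> (\<Union>f\<in>edges G - {e}. rng G f) = {} \<and> A \<inter> src G ` edges G = {} \<or>
      A = {src G e} \<and> A \<inter> src G ` (edges G - {e}) = {} \<and> A \<inter> (\<Union>f\<in>edges G. rng G f) = {})"

text \<open>As in the source, the ``extreme vertices'' are sets of vertices.\<close>

definition extreme_vertices :: "('v, 'e) ugraph \<Rightarrow> 'v set set" where
  "extreme_vertices G = {A. \<exists>e. extreme_edge_of G A e}"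

definition extreme_edges :: "('v, 'e) ugraph \<Rightarrow> 'e set" where
  "extreme_edges G = {e. \<exists>A. extreme_edge_of G A e}"

definition isolated_vertices :: "('v, 'e) ugraph \<Rightarrow> 'v set" where
  "isolated_vertices G = verts G - ((\<Union>e\<in>edges G. rng G e) \<union> src G ` edges G)"

definition remove_isolated :: "('v, 'e) ugraph \<Rightarrow> ('v, 'e) ugraph" where
  "remove_isolated G = G\<lparr>verts := verts G - isolated_vertices G\<rparr>"

definition remove_extreme :: "('v, 'e) ugraph \<Rightarrow> ('v, 'e) ugraph" where
  "remove_extreme G =
     G\<lparr>verts := verts G - \<Union>(extreme_vertices G), edges := edges G - extreme_edges G\<rparr>"

text \<open>
  \<open>stage G n\<close> is \<open>\<bbbG>\<^sub>n\<close>, \<open>stage_extreme G n\<close> is \<open>X\<^sub>n\<close> and \<open>stage_isolated G n\<close> is \<open>I\<^sub>n\<close>. There is no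
  \<open>X\<^sub>0\<close>; its value here is a dummy. The recursion continues past an empty \<open>X\<^sub>n\<close>, from
  where on it is constant.
\<close>

primrec stage :: "('v, 'e) ugraph \<Rightarrow> nat \<Rightarrow> ('v, 'e) ugraph" where
  "stage G 0 = remove_isolated G"
| "stage G (Suc n) = remove_isolated (remove_extreme (stage G n))"

primrec stage_extreme :: "('v, 'e) ugraph \<Rightarrow> nat \<Rightarrow> 'v set set" where
  "stage_extreme G 0 = {}"
| "stage_extreme G (Suc n) = extreme_vertices (stage G n)"

primrec stage_isolated :: "('v, 'e) ugraph \<Rightarrow> nat \<Rightarrow> 'v set" where
  "stage_isolated G 0 = isolated_vertices G"
| "stage_isolated G (Suc n) = isolated_vertices (remove_extreme (stage G n))"

end

theory Submission
  imports Defs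
begin

text \<open>
  In a path of edges, each of the intermediate edges has its source in another range and its range
  meets another source, so one stage of the removal can only delete the two end edges. Hence if
  finitely many stages exhaust the non-isolated vertices, there is no infinite forward path and the
  relation ``\<open>w \<in> r(e)\<close> for some \<open>e\<close> with \<open>s(e) = v\<close>'' is well-founded. Bases \<open>B\<^sub>v\<close> are then chosen
  by recursion along it: the operators \<open>\<pi>(s\<^sub>e)\<close> carry \<open>B\<^bsub>r(e)\<^esub>\<close>, the union of the \<open>B\<^sub>w\<close> with
  \<open>w \<in> r(e)\<close>, isometrically onto an orthonormal basis of \<open>H\<^sub>e\<close>, and the subspaces \<open>H\<^sub>e\<close> with
  \<open>s(e) = v\<close> of \<open>H\<^sub>v\<close> are mutually orthogonal, so all these images extend to a basis of \<open>H\<^sub>v\<close>.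
\<close>

section \<open>Hilbert space geometry\<close>

lemma cinner_add_right: "cinner x (y + z) = cinner x y + cinner x z"
  for x y z :: "'h::complex_inner"
  by (metis cinner_add_left cinner_commute complex_cnj_add)

lemma cinner_scaleC_right: "cinner x (c *\<^sub>C y) = cnj c * cinner x y"
  for x y :: "'h::complex_inner"
  by (metis cinner_scaleC_left cinner_commute complex_cnj_mult)

lemma uminus_scaleC: "- x = (-1) *\<^sub>C x" for x :: "'h::complex_inner"
  using scaleR_scaleC[of "-1" x] by simp

lemma cinner_minus_left: "cinner (- x) y = - cinner x y" for x y :: "'h::complex_inner"
  by (simp add: uminus_scaleC cinner_scaleC_left del: complex_vector.scale_minus_left)

lemma cinner_minus_right: "cinner x (- y) = - cinner x y" for x y :: "'h::complex_inner"
  by (simp add: uminus_scaleC cinner_scaleC_right del: complex_vector.scale_minus_left)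

lemma cinner_diff_left: "cinner (x - y) z = cinner x z - cinner y z"
  for x y z :: "'h::complex_inner"
  using cinner_add_left[of x "- y" z] by (simp add: cinner_minus_left)

lemma cinner_diff_right: "cinner x (y - z) = cinner x y - cinner x z"
  for x y z :: "'h::complex_inner"
  using cinner_add_right[of x y "- z"] by (simp add: cinner_minus_right)

lemma cinner_zero_left [simp]: "cinner 0 x = 0" for x :: "'h::complex_inner"
  using cinner_diff_left[of 0 0 x] by simp

lemma cinner_zero_right [simp]: "cinner x 0 = 0" for x :: "'h::complex_inner"
  using cinner_diff_right[of x 0 0] by simp

lemma cinner_self_eq_0_iff [simp]: "cinner x x = 0 \<longleftrightarrow> x = 0" for x :: "'h::complex_inner"
  by (simp add: cinner_norm)

lemma cinner_eq_0_commute: "cinner x y = 0 \<longleftrightarrow> cinner y x = 0" for x y :: "'h::complex_inner"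
  by (metis cinner_commute complex_cnj_zero)

lemma power2_norm_eq_Re_cinner: "(norm x)\<^sup>2 = Re (cinner x x)" for x :: "'h::complex_inner"
  by (simp add: cinner_norm)

lemma cinner_eqI:
  fixes a b :: "'h::complex_inner"
  assumes "\<And>x. cinner x a = cinner x b"
  shows "a = b"
proof -
  have "cinner (a - b) (a - b) = 0"
    by (simp add: cinner_diff_right[of "a - b"] assms)
  then show ?thesis by simp
qed

section \<open>Cauchy-Schwarz inequality and orthogonal projection\<close>

lemma norm_scaleC: "norm (c *\<^sub>C x) = cmod c * norm x" for x :: "'h::complex_inner"
proof -
  have "cinner (c *\<^sub>C x) (c *\<^sub>C x) = (c * cnj c) * cinner x x"
    by (simp add: cinner_scaleC_left cinner_scaleC_right)
  then have "(norm (c *\<^sub>C x))\<^sup>2 = (cmod c)\<^sup>2 * (norm x)\<^sup>2"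
    by (simp only: cinner_norm complex_norm_square[symmetric] of_real_mult[symmetric] of_real_eq_iff)
  then show ?thesis
    by (simp flip: power_mult_distrib)
qed

text \<open>Pythagoras: the subtracted multiple of \<open>z\<close> is the component of
  \<open>u\<close> along \<open>z\<close>. Nonnegativity of the left side gives Cauchy-Schwarz, and
  the explicit gain on the right shows below that a nearest point has an orthogonal
  residual.\<close>

lemma norm_diff_projection:
  fixes u z :: "'h::complex_inner"
  assumes "z \<noteq> 0"
  shows "(norm (u - (cinner u z / complex_of_real ((norm z)\<^sup>2)) *\<^sub>C z))\<^sup>2
           = (norm u)\<^sup>2 - (cmod (cinner u z))\<^sup>2 / (norm z)\<^sup>2"
proof -
  define w where "w = cinner u z"
  define c where "c = w / complex_of_real ((norm z)\<^sup>2)"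
  have cz: "c * cinner z z = w"
    using assms by (simp add: c_def cinner_norm)
  have zu: "cinner z u = cnj w"
    by (metis w_def cinner_commute)
  have "cinner (u - c *\<^sub>C z) (u - c *\<^sub>C z)
      = cinner u u - cnj c * w - c * cnj w + cnj c * (c * cinner z z)"
    by (simp add: cinner_diff_left cinner_diff_right cinner_scaleC_left cinner_scaleC_right
        zu w_def[symmetric] algebra_simps)
  also have "\<dots> = cinner u u - c * cnj w"
    by (simp add: cz)
  also have "c * cnj w = complex_of_real ((cmod w)\<^sup>2 / (norm z)\<^sup>2)"
    by (simp add: c_def flip: complex_norm_square)
  finally show ?thesis
    by (simp add: power2_norm_eq_Re_cinner c_def w_def)
qed

lemma cauchy_schwarz: "cmod (cinner x y) \<le> norm x * norm y" for x y :: "'h::complex_inner"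
proof (cases "y = 0")
  case False
  have "(cmod (cinner x y))\<^sup>2 / (norm y)\<^sup>2 \<le> (norm x)\<^sup>2"
    using norm_diff_projection[OF False, of x] by (smt (verit) zero_le_power2)
  then have "(cmod (cinner x y))\<^sup>2 \<le> (norm x * norm y)\<^sup>2"
    using False by (simp add: divide_le_eq power_mult_distrib)
  then show ?thesis
    by (rule power2_le_imp_le) simp
qed simp

lemma bounded_linear_cinner_left: "bounded_linear (\<lambda>x. cinner x y)" for y :: "'h::complex_inner"
  by (rule bounded_linear_intro[where K = "norm y"])
     (simp_all add: cinner_add_left scaleR_scaleC cinner_scaleC_left cauchy_schwarz scaleR_conv_of_real)

lemma bounded_linear_scaleC: "bounded_linear (\<lambda>x::'h::complex_inner. c *\<^sub>C x)"
  by (rule bounded_linear_intro[where K = "cmod c"])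
     (simp_all add: scaleC_add_right scaleR_scaleC scaleC_scaleC norm_scaleC mult.commute)

lemma parallelogram:
  fixes x y :: "'h::complex_inner"
  shows "(norm (x + y))\<^sup>2 + (norm (x - y))\<^sup>2 = 2 * (norm x)\<^sup>2 + 2 * (norm y)\<^sup>2"
  by (simp add: power2_norm_eq_Re_cinner cinner_add_left cinner_add_right cinner_diff_left
      cinner_diff_right)

lemma subspace_scaleR:
  fixes S :: "'h::complex_inner set"
  assumes "complex_vector.subspace S" "x \<in> S"
  shows "t *\<^sub>R x \<in> S"
  using assms by (simp add: scaleR_scaleC complex_vector.subspace_scale)

text \<open>The sets of near-minimisers of the distance to \<open>x\<close> are closed, nested and
  of diameter tending to 0, so completeness yields a nearest point \<open>y\<close>. If
  \<open>x - y\<close> had a component along some \<open>z\<close> in \<open>S\<close>, moving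
  \<open>y\<close> by it would come closer.\<close>

theorem orthogonal_projection_exists:
  fixes S :: "'h::chilbert_space set"
  assumes "closed S" and sub: "complex_vector.subspace S"
  obtains y where "y \<in> S" "\<And>z. z \<in> S \<Longrightarrow> cinner (x - y) z = 0"
proof -
  define d where "d = (INF z\<in>S. (norm (x - z))\<^sup>2)"
  have S0: "0 \<in> S"
    using sub by (rule complex_vector.subspace_0)
  have bdd: "bdd_below ((\<lambda>z. (norm (x - z))\<^sup>2) ` S)"
    by (rule bdd_belowI[of _ 0]) auto
  have d_le: "d \<le> (norm (x - z))\<^sup>2" if "z \<in> S" for z
    unfolding d_def using bdd that by (rule cINF_lower)
  define C where "C n = {z\<in>S. (norm (x - z))\<^sup>2 \<le> d + inverse (real (Suc n))}" for n
  have "\<exists>y. \<forall>n. y \<in> C n"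
  proof (rule decreasing_closed_nest[of C])
    fix n
    have "C n = S \<inter> {z. (norm (x - z))\<^sup>2 \<le> d + inverse (real (Suc n))}"
      by (auto simp: C_def)
    then show "closed (C n)"
      using \<open>closed S\<close> by (auto intro!: closed_Int closed_Collect_le continuous_intros)
    have "\<exists>r\<in>(\<lambda>z. (norm (x - z))\<^sup>2) ` S. r < d + inverse (real (Suc n))"
      using S0 bdd by (subst cInf_less_iff[symmetric]) (auto simp: d_def)
    then show "C n \<noteq> {}"
      by (force simp: C_def)
  next
    fix m n :: nat
    assume "m \<le> n"
    then have "inverse (real (Suc n)) \<le> inverse (real (Suc m))"
      by (intro le_imp_inverse_le) auto
    then show "C n \<subseteq> C m"
      unfolding C_def by (intro Collect_mono) linarith
  next
    fix e :: real
    assume "0 < e"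
    \<comment> \<open>The midpoint of two near-minimisers lies in \<open>S\<close>, hence at squared
      distance at least \<open>d\<close> from \<open>x\<close>. The parallelogram law then bounds
      the squared distance between them by \<open>4 * inverse (real (Suc n))\<close>, which accounts
      for the \<open>4\<close> here.\<close>
    then obtain n where n: "inverse (real (Suc n)) < e\<^sup>2 / 4"
      using reals_Archimedean[of "e\<^sup>2 / 4"] by auto
    have "dist a b < e" if "a \<in> C n" "b \<in> C n" for a b
    proof -
      have "(1 / 2) *\<^sub>R (a + b) \<in> S"
        using that sub by (auto simp: C_def intro!: subspace_scaleR complex_vector.subspace_add)
      then have "d \<le> (norm (x - (1 / 2) *\<^sub>R (a + b)))\<^sup>2"
        by (rule d_le)
      also have "x - (1 / 2) *\<^sub>R (a + b) = (1 / 2) *\<^sub>R ((x - a) + (x - b))"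
        by (simp add: scaleR_add_right scaleR_diff_right) (metis field_sum_of_halves scaleR_add_left scaleR_one mult_2 diff_add_eq)
      finally have "4 * d \<le> (norm ((x - a) + (x - b)))\<^sup>2"
        by (simp add: power_divide)
      moreover have "norm ((x - a) - (x - b)) = dist a b"
        by (simp add: dist_norm norm_minus_commute)
      ultimately have "(dist a b)\<^sup>2 < e\<^sup>2"
        using parallelogram[of "x - a" "x - b"] that n by (simp add: C_def)
      then show ?thesis
        using \<open>0 < e\<close> by (simp add: power2_less_imp_less)
    qed
    then show "\<exists>n. \<forall>a\<in>C n. \<forall>b\<in>C n. dist a b < e"
      by blast
  qed blast
  then obtain y where y: "\<And>n. y \<in> C n"
    by blast
  have yS: "y \<in> S"
    using y[of 0] by (simp add: C_def)
  have y_min: "(norm (x - y))\<^sup>2 \<le> d"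
  proof (rule field_le_epsilon)
    fix e :: real
    assume "0 < e"
    then obtain n where "inverse (real (Suc n)) < e"
      using reals_Archimedean by blast
    then show "(norm (x - y))\<^sup>2 \<le> d + e"
      using y[of n] by (simp add: C_def)
  qed
  have "cinner (x - y) z = 0" if "z \<in> S" for z
  proof (cases "z = 0")
    case False
    let ?c = "cinner (x - y) z / complex_of_real ((norm z)\<^sup>2)"
    have "y + ?c *\<^sub>C z \<in> S"
      using yS that sub by (intro complex_vector.subspace_add complex_vector.subspace_scale)
    then have "d \<le> (norm (x - (y + ?c *\<^sub>C z)))\<^sup>2"
      by (rule d_le)
    then have "d \<le> (norm (x - y))\<^sup>2 - (cmod (cinner (x - y) z))\<^sup>2 / (norm z)\<^sup>2"
      using norm_diff_projection[OF False, of "x - y"] by (simp add: diff_diff_eq)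
    with y_min have "(cmod (cinner (x - y) z))\<^sup>2 / (norm z)\<^sup>2 \<le> 0"
      by simp
    then show ?thesis
      using False by (simp add: divide_le_0_iff)
  qed simp
  with yS show ?thesis
    by (rule that)
qed

section \<open>Closed linear spans and orthonormal bases\<close>

lemma subspace_closure:
  fixes S :: "'h::complex_inner set"
  assumes "complex_vector.subspace S"
  shows "complex_vector.subspace (closure S)"
proof (rule complex_vector.subspaceI)
  show "0 \<in> closure S"
    using assms closure_subset complex_vector.subspace_0 by blast
next
  fix x y
  assume "x \<in> closure S" "y \<in> closure S"
  then obtain f g where "\<And>n. f n \<in> S" "f \<longlonglongrightarrow> x" "\<And>n. g n \<in> S" "g \<longlonglongrightarrow> y"
    by (auto simp: closure_sequential)
  then show "x + y \<in> closure S"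
    unfolding closure_sequential
    by (intro exI[of _ "\<lambda>n. f n + g n"]) (auto intro: tendsto_add complex_vector.subspace_add[OF assms])
next
  fix c x
  assume "x \<in> closure S"
  then obtain f where "\<And>n. f n \<in> S" "f \<longlonglongrightarrow> x"
    by (auto simp: closure_sequential)
  then show "c *\<^sub>C x \<in> closure S"
    unfolding closure_sequential
    by (intro exI[of _ "\<lambda>n. c *\<^sub>C f n"])
       (auto intro: bounded_linear.tendsto[OF bounded_linear_scaleC] complex_vector.subspace_scale[OF assms])
qed

lemma subspace_closure_cspan: "complex_vector.subspace (closure (cspan B))"
  by (intro subspace_closure complex_vector.subspace_span)

lemma closure_cspan_minimal:
  assumes "B \<subseteq> M" "closed M" "complex_vector.subspace M"
  shows "closure (cspan B) \<subseteq> M"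
  using assms by (intro closure_minimal complex_vector.span_minimal)

lemma subset_closure_cspan: "B \<subseteq> closure (cspan B)"
  using complex_vector.span_superset closure_subset by blast

definition orthonormal :: "'h::complex_inner set \<Rightarrow> bool" where
  "orthonormal B \<longleftrightarrow> (\<forall>x\<in>B. norm x = 1) \<and> pairwise (\<lambda>x y. cinner x y = 0) B"

lemma orthonormal_basis_iff:
  "orthonormal_basis M B \<longleftrightarrow> orthonormal B \<and> closure (cspan B) = M"
  by (simp add: orthonormal_basis_def orthonormal_def)

lemma orthonormal_basis_subset: "orthonormal_basis M B \<Longrightarrow> B \<subseteq> M"
  using subset_closure_cspan by (auto simp: orthonormal_basis_iff)

text \<open>Orthonormality speaks of at most two vectors at a time, and any two in the union lie in
  a common member of the chain. This supplies the upper bounds for Zorn's lemma.\<close>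

lemma orthonormal_Union_chain:
  assumes "\<And>C. C \<in> \<C> \<Longrightarrow> orthonormal C" and "\<And>C D. C \<in> \<C> \<Longrightarrow> D \<in> \<C> \<Longrightarrow> C \<subseteq> D \<or> D \<subseteq> C"
  shows "orthonormal (\<Union>\<C>)"
  using assms unfolding orthonormal_def pairwise_def by (meson UnionE subsetD)

lemma orthonormal_UN:
  assumes "\<And>i. i \<in> I \<Longrightarrow> orthonormal (B i)" and "\<And>i. i \<in> I \<Longrightarrow> B i \<subseteq> M i"
    and "pairwise (\<lambda>i j. \<forall>x\<in>M i. \<forall>y\<in>M j. cinner x y = 0) I"
  shows "orthonormal (\<Union>i\<in>I. B i)"
  unfolding orthonormal_def pairwise_def
proof (intro conjI ballI impI)
  fix x assume "x \<in> (\<Union>i\<in>I. B i)"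
  then show "norm x = 1"
    using assms(1) by (auto simp: orthonormal_def)
next
  fix x y assume "x \<in> (\<Union>i\<in>I. B i)" "y \<in> (\<Union>i\<in>I. B i)" "x \<noteq> y"
  then obtain i j where ij: "i \<in> I" "j \<in> I" "x \<in> B i" "y \<in> B j"
    by blast
  show "cinner x y = 0"
  proof (cases "i = j")
    case True
    then show ?thesis
      using assms(1) ij \<open>x \<noteq> y\<close> by (auto simp: orthonormal_def pairwise_def)
  next
    case False
    then show ?thesis
      using assms(2,3) ij unfolding pairwise_def by blast
  qed
qed

text \<open>Zorn's lemma gives a maximal orthonormal set in \<open>M\<close> above
  \<open>B0\<close>. Were its closed span smaller than \<open>M\<close>, the normalised residual of
  a projection onto that span could be added.\<close>

theorem orthonormal_basis_extend:
  fixes M :: "'h::chilbert_space set"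
  assumes M: "closed M" "complex_vector.subspace M" and B0: "orthonormal B0" "B0 \<subseteq> M"
  obtains B where "orthonormal_basis M B" "B0 \<subseteq> B"
proof -
  let ?F = "{B. orthonormal B \<and> B \<subseteq> M \<and> B0 \<subseteq> B}"
  have "\<exists>B\<in>?F. \<forall>X\<in>?F. B \<subseteq> X \<longrightarrow> X = B"
  proof (rule subset_Zorn_nonempty)
    show "?F \<noteq> {}"
      using B0 by blast
    fix \<C>
    assume "\<C> \<noteq> {}" and chain: "subset.chain ?F \<C>"
    have "C \<subseteq> D \<or> D \<subseteq> C" if "C \<in> \<C>" "D \<in> \<C>" for C D
      using that chain unfolding subset_chain_def by blast
    moreover have "orthonormal C" if "C \<in> \<C>" for C
      using that chain unfolding subset_chain_def by blast
    ultimately have "orthonormal (\<Union>\<C>)"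
      by (intro orthonormal_Union_chain)
    with chain \<open>\<C> \<noteq> {}\<close> show "\<Union>\<C> \<in> ?F"
      by (auto simp: subset_chain_def)
  qed
  then obtain B where B: "orthonormal B" "B \<subseteq> M" "B0 \<subseteq> B"
    and max: "\<And>X. orthonormal X \<Longrightarrow> X \<subseteq> M \<Longrightarrow> B \<subseteq> X \<Longrightarrow> X = B"
    by (auto; blast)
  have sub: "closure (cspan B) \<subseteq> M"
    using B M by (intro closure_cspan_minimal)
  have "M \<subseteq> closure (cspan B)"
  proof
    fix x
    assume "x \<in> M"
    obtain y where y: "y \<in> closure (cspan B)" "\<And>z. z \<in> closure (cspan B) \<Longrightarrow> cinner (x - y) z = 0"
      using orthogonal_projection_exists[OF closed_closure subspace_closure_cspan] by metis
    show "x \<in> closure (cspan B)"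
    proof (rule ccontr)
      assume "x \<notin> closure (cspan B)"
      with y(1) have "x \<noteq> y"
        by blast
      define u where "u = inverse (norm (x - y)) *\<^sub>R (x - y)"
      have u: "norm u = 1"
        using \<open>x \<noteq> y\<close> by (simp add: u_def)
      have "u \<in> M"
        unfolding u_def using \<open>x \<in> M\<close> y(1) sub M(2)
        by (intro subspace_scaleR complex_vector.subspace_diff) auto
      have orth: "cinner u z = 0" if "z \<in> closure (cspan B)" for z
        using y(2)[OF that] by (simp add: u_def scaleR_scaleC cinner_scaleC_left)
      have "orthonormal (insert u B)"
        using B(1) u orth subset_closure_cspan[of B]
        by (auto simp: orthonormal_def pairwise_insert cinner_eq_0_commute[of _ u])
      then have "insert u B = B"
        using B(2) \<open>u \<in> M\<close> by (intro max) auto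
      \<comment> \<open>By maximality \<open>u\<close> already belongs to \<open>B\<close>, to which
        it is orthogonal.\<close>
      then have "cinner u u = 0"
        using orth subset_closure_cspan by blast
      with u show False
        by auto
    qed
  qed
  with sub B show ?thesis
    by (intro that[of B]) (auto simp: orthonormal_basis_iff)
qed

text \<open>Each summand is the closed span of its own basis, so the union of the bases and the
  union of the summands have the same closed span. This later makes the union of the
  \<open>BV w\<close> with \<open>w\<close> in \<open>rng G e\<close> a basis of the range
  space.\<close>

lemma orthonormal_basis_UN:
  assumes "hilbert_direct_sum I M N" and "\<And>i. i \<in> I \<Longrightarrow> orthonormal_basis (M i) (B i)"
  shows "orthonormal_basis N (\<Union>i\<in>I. B i)"
proof -
  have "orthonormal (\<Union>i\<in>I. B i)"
    using assms by (intro orthonormal_UN[of I B M])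
      (auto simp: hilbert_direct_sum_def orthonormal_basis_iff intro: subsetD[OF subset_closure_cspan])
  moreover have "closure (cspan (\<Union>i\<in>I. B i)) = closure (cspan (\<Union>i\<in>I. M i))"
  proof
    show "closure (cspan (\<Union>i\<in>I. B i)) \<subseteq> closure (cspan (\<Union>i\<in>I. M i))"
      using assms(2) by (intro closure_mono complex_vector.span_mono UN_mono orthonormal_basis_subset) auto
    have "M i \<subseteq> closure (cspan (\<Union>i\<in>I. B i))" if "i \<in> I" for i
    proof -
      have "M i = closure (cspan (B i))"
        using assms(2)[OF that] by (simp add: orthonormal_basis_iff)
      also have "\<dots> \<subseteq> closure (cspan (\<Union>i\<in>I. B i))"
        using that by (intro closure_mono complex_vector.span_mono) auto
      finally show ?thesis .
    qed
    then show "closure (cspan (\<Union>i\<in>I. M i)) \<subseteq> closure (cspan (\<Union>i\<in>I. B i))"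
      by (intro closure_cspan_minimal closed_closure subspace_closure_cspan) auto
  qed
  ultimately show ?thesis
    using assms(1) by (simp add: orthonormal_basis_iff hilbert_direct_sum_def)
qed

section \<open>Adjoints\<close>

text \<open>The component \<open>u\<close> of some \<open>x\<close> outside the kernel orthogonal to
  that kernel is nonzero. Every \<open>z\<close> differs from a multiple of \<open>u\<close> by a
  kernel vector, so \<open>f\<close> is determined by the inner product with
  \<open>u\<close>.\<close>

theorem riesz_representation:
  fixes f :: "'h::chilbert_space \<Rightarrow> complex"
  assumes "bounded_linear f" and scale: "\<And>c x. f (c *\<^sub>C x) = c * f x"
  obtains y where "\<And>x. f x = cinner x y"
proof (cases "\<forall>x. f x = 0")
  case True
  then show ?thesis
    by (intro that[of 0]) simp
next
  case False
  then obtain x where x: "f x \<noteq> 0"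
    by blast
  interpret bounded_linear f by fact
  let ?K = "{z. f z = 0}"
  have "closed ?K"
    by (intro closed_Collect_eq continuous_on continuous_on_const continuous_on_id)
  moreover have "complex_vector.subspace ?K"
    by (rule complex_vector.subspaceI) (simp_all add: zero add assms(2))
  ultimately obtain k where k: "f k = 0" "\<And>z. f z = 0 \<Longrightarrow> cinner (x - k) z = 0"
    using orthogonal_projection_exists[of ?K x] by auto
  define u where "u = x - k"
  have fu: "f u \<noteq> 0"
    using x k(1) by (simp add: u_def diff)
  then have "u \<noteq> 0"
    using zero by metis
  \<comment> \<open>The conjugate compensates for conjugate linearity in the second
    argument.\<close>
  have "f z = cinner z ((cnj (f u) / cinner u u) *\<^sub>C u)" for z
  proof -
    have "f (z - (f z / f u) *\<^sub>C u) = 0"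
      using fu by (simp add: diff assms(2))
    then have "cinner u (z - (f z / f u) *\<^sub>C u) = 0"
      using k(2) by (simp add: u_def)
    then have "cinner (z - (f z / f u) *\<^sub>C u) u = 0"
      using cinner_eq_0_commute by blast
    then have "cinner z u = f z / f u * cinner u u"
      unfolding cinner_diff_left cinner_scaleC_left by simp
    then show ?thesis
      using fu \<open>u \<noteq> 0\<close> by (simp add: cinner_scaleC_right cinner_commute[of u u, symmetric])
  qed
  then show ?thesis
    by (rule that)
qed

text \<open>As \<open>adjoint_op\<close> is a definite description, the defining property must be
  shown to have exactly one solution. Membership in the carrier provides the complex linearity that
  the Riesz theorem asks for.\<close>

lemma cinner_adjoint_op:
  fixes T :: "'h::chilbert_space \<Rightarrow>\<^sub>L 'h"
  assumes "T \<in> carrier bounded_operators"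
  shows "cinner (blinfun_apply T x) y = cinner x (blinfun_apply (adjoint_op T) y)"
proof -
  have scale: "blinfun_apply T (c *\<^sub>C x) = c *\<^sub>C blinfun_apply T x" for c x
    using assms by (simp add: bounded_operators_def)
  have "\<exists>z. \<forall>x. cinner (blinfun_apply T x) y = cinner x z" for y
    by (rule riesz_representation[of "\<lambda>x. cinner (blinfun_apply T x) y"])
       (auto simp: scale cinner_scaleC_left
         intro: bounded_linear_compose[OF bounded_linear_cinner_left blinfun.bounded_linear_right])
  then obtain S where S: "\<And>x y. cinner (blinfun_apply T x) y = cinner x (S y)"
    by metis
  have "bounded_linear S"
  proof (rule bounded_linear_intro[where K = "norm T"])
    show "S (a + b) = S a + S b" for a b
      by (rule cinner_eqI) (simp add: S[symmetric] cinner_add_right)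
    show "S (t *\<^sub>R a) = t *\<^sub>R S a" for t a
      by (rule cinner_eqI) (simp add: S[symmetric] scaleR_scaleC cinner_scaleC_right)
    show "norm (S a) \<le> norm a * norm T" for a
    proof (cases "S a = 0")
      case False
      \<comment> \<open>Testing the adjoint relation at \<open>S a\<close> bounds the square of its
        norm; one factor is then cancelled.\<close>
      have "norm (S a) * norm (S a) = cmod (cinner (S a) (S a))"
        by (simp add: cinner_norm norm_mult power2_eq_square)
      also have "\<dots> = cmod (cinner (blinfun_apply T (S a)) a)"
        by (simp add: S)
      also have "\<dots> \<le> norm (blinfun_apply T (S a)) * norm a"
        by (rule cauchy_schwarz)
      also have "\<dots> \<le> (norm T * norm (S a)) * norm a"
        by (intro mult_right_mono norm_blinfun) auto
      finally show ?thesis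
        using False by (simp add: algebra_simps)
    qed simp
  qed
  then have ex: "\<forall>x y. cinner (blinfun_apply T x) y = cinner x (blinfun_apply (Blinfun S) y)"
    by (simp add: S bounded_linear_Blinfun_apply)
  have "\<forall>x y. cinner (blinfun_apply T x) y = cinner x (blinfun_apply (adjoint_op T) y)"
    unfolding adjoint_op_def
  proof (rule theI[where a = "Blinfun S"])
    show "\<forall>x y. cinner (blinfun_apply T x) y = cinner x (blinfun_apply (Blinfun S) y)"
      by (rule ex)
    fix S' assume "\<forall>x y. cinner (blinfun_apply T x) y = cinner x (blinfun_apply S' y)"
    with ex show "S' = Blinfun S"
      by (intro blinfun_eqI cinner_eqI) metis
  qed
  then show ?thesis
    by blast
qed

section \<open>Iterated removal of extreme vertices\<close>

lemma rng_stage [simp]: "rng (stage G k) = rng G"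
  by (induction k) (simp_all add: remove_isolated_def remove_extreme_def)

lemma src_stage [simp]: "src (stage G k) = src G"
  by (induction k) (simp_all add: remove_isolated_def remove_extreme_def)

lemma edges_stage_0: "edges (stage G 0) = edges G"
  by (simp add: remove_isolated_def)

lemma edges_stage_Suc: "edges (stage G (Suc k)) = edges (stage G k) - extreme_edges (stage G k)"
  by (simp add: remove_isolated_def remove_extreme_def)

lemma edges_stage_antimono:
  assumes "k \<le> m"
  shows "edges (stage G m) \<subseteq> edges (stage G k)"
  using assms
proof (induction m rule: dec_induct)
  case (step m)
  then show ?case
    unfolding edges_stage_Suc by blast
qed simp

text \<open>A surviving edge protects its source: the source is never isolated while the edge is
  present, and it could lie in an extreme set only if the edge itself were extreme and hence
  deleted.\<close>

lemma src_notin_removed: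
  assumes "e \<in> edges (stage G k)" "i \<in> {1..k}"
  shows "src G e \<notin> \<Union>(stage_extreme G i) \<union> stage_isolated G i"
proof -
  obtain j where i: "i = Suc j"
    using assms(2) by (cases i) auto
  have e: "e \<in> edges (stage G j)" "e \<notin> extreme_edges (stage G j)"
    using assms edges_stage_antimono[of i k G] unfolding i edges_stage_Suc by auto
  have "src G e \<notin> X" if "extreme_edge_of (stage G j) X f" for X f
  proof
    assume "src G e \<in> X"
    \<comment> \<open>An extreme set that is a range misses all sources, and one that is a source
      misses the sources of all edges but its own.\<close>
    with that e(1) have "f = e"
      by (auto simp: extreme_edge_of_def)
    with that e(2) show False
      by (auto simp: extreme_edges_def)
  qed
  moreover have "src G e \<notin> isolated_vertices (remove_extreme (stage G j))"
    using e by (auto simp: isolated_vertices_def remove_extreme_def)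
  ultimately show ?thesis
    by (auto simp: i extreme_vertices_def)
qed

text \<open>Only the two ends of a path can be removed in a single stage.\<close>

lemma infinite_path_edges_stage:
  assumes "\<And>i. e i \<in> edges G" "\<And>i. src G (e (Suc i)) \<in> rng G (e i)" "k \<le> i"
  shows "e i \<in> edges (stage G k)"
  using assms(3)
proof (induction k arbitrary: i)
  case 0
  show ?case
    using assms(1) by (simp only: edges_stage_0)
next
  case (Suc k)
  \<comment> \<open>Membership of \<open>e i\<close> after one more stage is secured by its
    neighbours \<open>e j\<close> and \<open>e (Suc i)\<close>. A predecessor is required, so each
    stage may cost one edge at the front, whence the bound \<open>k \<le> i\<close>.\<close>
  then obtain j where i: "i = Suc j" and "k \<le> j"
    by (cases i) auto
  then have "e j \<in> edges (stage G k)" "e i \<in> edges (stage G k)" "e (Suc i) \<in> edges (stage G k)"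
    by (auto intro: Suc.IH)
  moreover have "src G (e i) \<in> rng G (e j)" "src G (e (Suc i)) \<in> rng G (e i)"
    using assms(2) i by auto
  \<comment> \<open>The successor's source refutes the range case and the predecessor's range the
    source case. Both conditions run over all edges, so repetitions along the path do no
    harm.\<close>
  ultimately have "\<not> extreme_edge_of (stage G k) X (e i)" for X
    by (auto simp: extreme_edge_of_def)
  with \<open>e i \<in> edges (stage G k)\<close> show ?case
    unfolding edges_stage_Suc by (simp add: extreme_edges_def)
qed

text \<open>The range vertex is the smaller one, so recursion at a source may use the bases already
  chosen at all its range vertices.\<close>

definition edge_rel :: "('v, 'e) ugraph \<Rightarrow> ('v \<times> 'v) set" where
  "edge_rel G = {(w, v). \<exists>e\<in>edges G. src G e = v \<and> w \<in> rng G e}"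

text \<open>A descending chain is an infinite forward path. Its edge number \<open>n\<close>
  survives \<open>n\<close> stages, so the source of that edge escapes the sets that were assumed to
  cover all sources.\<close>

theorem wf_edge_rel:
  assumes "src G ` edges G \<subseteq> (\<Union>i\<in>{1..n}. \<Union>(stage_extreme G i) \<union> stage_isolated G i)"
  shows "wf (edge_rel G)"
  unfolding wf_iff_no_infinite_down_chain
proof
  assume "\<exists>f. \<forall>i. (f (Suc i), f i) \<in> edge_rel G"
  then obtain f where "\<And>i. \<exists>e\<in>edges G. src G e = f i \<and> f (Suc i) \<in> rng G e"
    by (simp add: edge_rel_def) blast
  then obtain e where e: "\<And>i. e i \<in> edges G" "\<And>i. src G (e i) = f i" "\<And>i. f (Suc i) \<in> rng G (e i)"
    by metis
  then have "e n \<in> edges (stage G n)"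
    by (intro infinite_path_edges_stage) auto
  then have "src G (e n) \<notin> (\<Union>i\<in>{1..n}. \<Union>(stage_extreme G i) \<union> stage_isolated G i)"
    using src_notin_removed by fastforce
  with assms e(1) show False
    by blast
qed

section \<open>Representations of ultragraph algebras\<close>

text \<open>Ranges of projections become solution sets of equations, from which closedness and
  linearity can be read off.\<close>

lemma range_idempotent:
  assumes "\<And>u. f (f u) = f u"
  shows "range f = {u. f u = u}"
  by (auto simp: assms) (metis rangeI)

locale ultragraph_representation = ultragraph G + cstar_algebra A
  for G :: "('v, 'e) ugraph" and A :: "'a cstar" (structure) +
  fixes s :: "'e \<Rightarrow> 'a" and p :: "'v set \<Rightarrow> 'a" and \<pi> :: "'a \<Rightarrow> ('h::chilbert_space \<Rightarrow>\<^sub>L 'h)"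
  assumes family: "ultragraph_family G A s p"
    and hom: "\<pi> \<in> star_hom A bounded_operators"
begin

abbreviation P :: "'v set \<Rightarrow> 'h \<Rightarrow> 'h" where "P X \<equiv> blinfun_apply (\<pi> (p X))"
abbreviation T :: "'e \<Rightarrow> 'h \<Rightarrow> 'h" where "T e \<equiv> blinfun_apply (\<pi> (s e))"
abbreviation T' :: "'e \<Rightarrow> 'h \<Rightarrow> 'h" where "T' e \<equiv> blinfun_apply (\<pi> (star A (s e)))"

section \<open>The defining relations as identities of operators\<close>

lemma hom_carrier: "x \<in> carrier A \<Longrightarrow> \<pi> x \<in> carrier bounded_operators"
  using hom by (auto simp: star_hom_def)

lemma hom_scaleC:
  "x \<in> carrier A \<Longrightarrow> blinfun_apply (\<pi> x) (c *\<^sub>C u) = c *\<^sub>C blinfun_apply (\<pi> x) u"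
  using hom_carrier by (simp add: bounded_operators_def)

lemma hom_add: "x \<in> carrier A \<Longrightarrow> y \<in> carrier A \<Longrightarrow> \<pi> (x \<oplus> y) = \<pi> x + \<pi> y"
  using hom by (simp add: star_hom_def bounded_operators_def)

lemma hom_zero: "\<pi> \<zero> = 0"
  using hom_add[of \<zero> \<zero>] by simp

lemma hom_mult:
  "x \<in> carrier A \<Longrightarrow> y \<in> carrier A \<Longrightarrow>
    blinfun_apply (\<pi> (x \<otimes> y)) u = blinfun_apply (\<pi> x) (blinfun_apply (\<pi> y) u)"
  using hom by (simp add: star_hom_def bounded_operators_def)

lemma cinner_hom:
  assumes "x \<in> carrier A"
  shows "cinner (blinfun_apply (\<pi> x) u) v = cinner u (blinfun_apply (\<pi> (star A x)) v)"
proof -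
  have "\<pi> (star A x) = adjoint_op (\<pi> x)"
    using hom assms by (simp add: star_hom_def bounded_operators_def)
  then show ?thesis
    using cinner_adjoint_op[OF hom_carrier[OF assms]] by simp
qed

lemma p_closed: "X \<in> vsets G \<Longrightarrow> p X \<in> carrier A"
  using family by (auto simp: ultragraph_family_def projection_def)

lemma s_closed: "e \<in> edges G \<Longrightarrow> s e \<in> carrier A"
  using family by (auto simp: ultragraph_family_def partial_isometry_def)

lemma vset_src: "e \<in> edges G \<Longrightarrow> {src G e} \<in> vsets G"
  by (simp add: src_closed vsets.vertex)

lemma P_P:
  assumes "X \<in> vsets G" "Y \<in> vsets G"
  shows "P X (P Y u) = P (X \<inter> Y) u"
proof -
  have "p X \<otimes> p Y = p (X \<inter> Y)"
    using family assms by (simp add: ultragraph_family_def)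
  then show ?thesis
    using assms by (simp add: p_closed flip: hom_mult)
qed

lemma P_empty: "P {} u = 0"
  using family by (simp add: ultragraph_family_def hom_zero)

lemma cinner_P:
  assumes "X \<in> vsets G"
  shows "cinner (P X u) v = cinner u (P X v)"
proof -
  have "star A (p X) = p X"
    using family assms by (simp add: ultragraph_family_def projection_def)
  then show ?thesis
    using cinner_hom[OF p_closed[OF assms]] by simp
qed

lemma cinner_T: "e \<in> edges G \<Longrightarrow> cinner (T e u) v = cinner u (T' e v)"
  by (simp add: cinner_hom s_closed)

lemma T'_T:
  assumes "e \<in> edges G"
  shows "T' e (T e u) = P (rng G e) u"
proof -
  have "star A (s e) \<otimes> s e = p (rng G e)"
    using family assms by (simp add: ultragraph_family_def)
  then show ?thesis
    using assms by (simp add: s_closed star_closed flip: hom_mult)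
qed

lemma T_T'_T:
  assumes "e \<in> edges G"
  shows "T e (T' e (T e u)) = T e u"
proof -
  have "s e \<otimes> star A (s e) \<otimes> s e = s e"
    using family assms by (simp add: ultragraph_family_def partial_isometry_def)
  then have "blinfun_apply (\<pi> (s e \<otimes> star A (s e) \<otimes> s e)) u = T e u"
    by simp
  then show ?thesis
    using assms by (simp add: s_closed star_closed mult_closed hom_mult)
qed

lemma T_T'_orthogonal:
  assumes "e \<in> edges G" "f \<in> edges G" "e \<noteq> f"
  shows "T e (T' e (T f (T' f u))) = 0"
proof -
  have "(s e \<otimes> star A (s e)) \<otimes> (s f \<otimes> star A (s f)) = \<zero>"
    using family assms by (simp add: ultragraph_family_def)
  then have "blinfun_apply (\<pi> ((s e \<otimes> star A (s e)) \<otimes> (s f \<otimes> star A (s f)))) u = 0"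
    by (simp add: hom_zero)
  then show ?thesis
    using assms by (simp add: s_closed star_closed mult_closed hom_mult)
qed

text \<open>This exploits the order relation between the range projection of \<open>s e\<close> and
  \<open>p {src G e}\<close>: writing the difference as \<open>star A z \<otimes> z\<close> and
  pairing with \<open>u\<close> gives a vanishing sum of two squared norms, one of them that of
  \<open>T' e u\<close>.\<close>

lemma T'_eq_0:
  assumes e: "e \<in> edges G" and u: "P {src G e} u = 0"
  shows "T' e u = 0"
proof -
  let ?q = "s e \<otimes> star A (s e)"
  have q: "?q \<in> carrier A"
    using e by (simp add: s_closed star_closed mult_closed)
  have pc: "p {src G e} \<in> carrier A"
    using e by (simp add: p_closed vset_src)
  obtain z where z: "z \<in> carrier A" "p {src G e} \<ominus> ?q = star A z \<otimes> z"
    using family e by (auto simp: ultragraph_family_def cstar_le_def)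
  have "p {src G e} = (p {src G e} \<ominus> ?q) \<oplus> ?q"
    using pc q by (simp add: minus_eq add.m_assoc l_neg)
  then have "p {src G e} = star A z \<otimes> z \<oplus> ?q"
    using z(2) by simp
  then have "P {src G e} u = blinfun_apply (\<pi> (star A z)) (blinfun_apply (\<pi> z) u) + T e (T' e u)"
    using e q z(1) by (simp add: hom_add hom_mult blinfun.add_left star_closed mult_closed s_closed)
  then have "0 = cinner u (blinfun_apply (\<pi> (star A z)) (blinfun_apply (\<pi> z) u)) + cinner u (T e (T' e u))"
    using u by (simp flip: cinner_add_right)
  also have "\<dots> = cinner (blinfun_apply (\<pi> z) u) (blinfun_apply (\<pi> z) u) + cinner (T' e u) (T' e u)"
    using e z(1) by (simp add: cinner_hom star_closed star_star s_closed)
  also have "\<dots> = complex_of_real ((norm (blinfun_apply (\<pi> z) u))\<^sup>2 + (norm (T' e u))\<^sup>2)"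
    by (simp add: cinner_norm)
  finally have "(norm (blinfun_apply (\<pi> z) u))\<^sup>2 + (norm (T' e u))\<^sup>2 = 0"
    by (metis of_real_eq_0_iff)
  then show ?thesis
    by (simp add: sum_power2_eq_zero_iff)
qed

text \<open>The part \<open>w\<close> of \<open>T e u\<close> outside the source space is killed by
  the vertex projection, hence by \<open>T' e\<close>. So \<open>w\<close> is orthogonal to
  \<open>T e u\<close> and to its projection, and therefore to itself.\<close>

lemma P_src_T:
  assumes e: "e \<in> edges G"
  shows "P {src G e} (T e u) = T e u"
proof -
  let ?v = "{src G e}"
  define w where "w = T e u - P ?v (T e u)"
  have Pw: "P ?v w = 0"
    using e by (simp add: w_def blinfun.diff_right P_P vset_src)
  have "cinner w (P ?v (T e u)) = 0"
    using Pw e by (simp add: vset_src flip: cinner_P)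
  moreover have "cinner w (T e u) = 0"
    unfolding cinner_eq_0_commute[of w] using T'_eq_0[OF e Pw] by (simp add: cinner_T e)
  ultimately have "cinner w w = 0"
    using cinner_diff_right[of w "T e u" "P ?v (T e u)"] by (simp flip: w_def)
  then show ?thesis
    by (simp add: w_def)
qed

section \<open>The subspaces of vertex sets and of edges\<close>

lemma vset_space_eq:
  assumes "X \<in> vsets G"
  shows "vset_space p \<pi> X = {u. P X u = u}"
proof -
  have "P X (P X u) = P X u" for u
    using assms by (simp add: P_P)
  then show ?thesis
    unfolding vset_space_def by (rule range_idempotent)
qed

lemma closed_vset_space:
  assumes "X \<in> vsets G"
  shows "closed (vset_space p \<pi> X)"
  unfolding vset_space_eq[OF assms] by (intro closed_Collect_eq continuous_intros)

lemma subspace_vset_space: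
  assumes "X \<in> vsets G"
  shows "complex_vector.subspace (vset_space p \<pi> X)"
  unfolding vset_space_eq[OF assms] using assms
  by (intro complex_vector.subspaceI) (simp_all add: blinfun.add_right hom_scaleC p_closed)

lemma vset_space_orthogonal:
  assumes "X \<in> vsets G" "Y \<in> vsets G" "X \<inter> Y = {}" "x \<in> vset_space p \<pi> X" "y \<in> vset_space p \<pi> Y"
  shows "cinner x y = 0"
proof -
  have "cinner x y = cinner (P X x) (P Y y)"
    using assms by (simp add: vset_space_eq)
  also have "\<dots> = cinner x (P X (P Y y))"
    using assms by (simp add: cinner_P)
  also have "P X (P Y y) = 0"
    using assms by (simp add: P_P P_empty)
  finally show ?thesis
    by simp
qed

lemma edge_space_eq:
  assumes "e \<in> edges G"
  shows "edge_space A s \<pi> e = {u. T e (T' e u) = u}"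
proof -
  have "blinfun_apply (\<pi> (s e \<otimes> star A (s e))) = (\<lambda>u. T e (T' e u))"
    using assms by (simp add: hom_mult s_closed star_closed fun_eq_iff)
  then show ?thesis
    unfolding edge_space_def using T_T'_T[OF assms] by (simp add: range_idempotent)
qed

lemma closed_edge_space:
  assumes "e \<in> edges G"
  shows "closed (edge_space A s \<pi> e)"
  unfolding edge_space_eq[OF assms] by (intro closed_Collect_eq continuous_intros)

lemma subspace_edge_space:
  assumes "e \<in> edges G"
  shows "complex_vector.subspace (edge_space A s \<pi> e)"
  unfolding edge_space_eq[OF assms] using assms
  by (intro complex_vector.subspaceI)
     (simp_all add: blinfun.add_right hom_scaleC s_closed star_closed)

lemma edge_space_orthogonal:
  assumes "e \<in> edges G" "f \<in> edges G" "e \<noteq> f" "x \<in> edge_space A s \<pi> e" "y \<in> edge_space A s \<pi> f"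
  shows "cinner x y = 0"
proof -
  have "cinner x y = cinner (T e (T' e x)) (T f (T' f y))"
    using assms by (simp add: edge_space_eq)
  also have "\<dots> = cinner x (T e (T' e (T f (T' f y))))"
    using assms(1) by (simp add: cinner_hom s_closed star_closed star_star)
  also have "\<dots> = 0"
    using assms by (simp add: T_T'_orthogonal)
  finally show ?thesis .
qed

lemma edge_space_subset:
  assumes "e \<in> edges G"
  shows "edge_space A s \<pi> e \<subseteq> vset_space p \<pi> {src G e}"
  using assms by (auto simp: edge_space_eq vset_space_eq vset_src) (metis P_src_T)

section \<open>Transport and choice of bases\<close>

text \<open>\<open>T' e\<close> after \<open>T e\<close> is the projection onto the range space, so
  \<open>T e\<close> preserves inner products there. It reaches all of the edge space because
  \<open>T' e\<close> maps that space back into the range space.\<close>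

lemma orthonormal_basis_image_T:
  assumes e: "e \<in> edges G" and B: "orthonormal_basis (vset_space p \<pi> (rng G e)) B"
  shows "orthonormal_basis (edge_space A s \<pi> e) (T e ` B)"
proof -
  have iso: "cinner (T e x) (T e y) = cinner x y" if "y \<in> B" for x y
  proof -
    have "P (rng G e) y = y"
      using that orthonormal_basis_subset[OF B] vset_space_eq[OF vsets.range[OF e]] by auto
    then show ?thesis
      using e by (simp add: cinner_T T'_T)
  qed
  have "norm (T e x) = 1" if "x \<in> B" for x
  proof -
    have "(norm (T e x))\<^sup>2 = (norm x)\<^sup>2"
      by (simp add: power2_norm_eq_Re_cinner iso that)
    then show ?thesis
      using B that by (simp add: orthonormal_basis_def)
  qed
  moreover have "pairwise (\<lambda>x y. cinner x y = 0) (T e ` B)"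
    using B by (auto simp: pairwise_def orthonormal_basis_def iso)
  moreover have "closure (cspan (T e ` B)) = edge_space A s \<pi> e"
  proof
    have "T e ` B \<subseteq> edge_space A s \<pi> e"
      using e by (auto simp: edge_space_eq T_T'_T)
    then show "closure (cspan (T e ` B)) \<subseteq> edge_space A s \<pi> e"
      using e by (intro closure_cspan_minimal closed_edge_space subspace_edge_space)
    \<comment> \<open>The preimage of a closed subspace under \<open>T e\<close> is a closed
      subspace; containing \<open>B\<close>, it contains the whole range space.\<close>
    let ?V = "{x. T e x \<in> closure (cspan (T e ` B))}"
    have "closure (cspan B) \<subseteq> ?V"
    proof (rule closure_cspan_minimal)
      show "B \<subseteq> ?V"
        using subset_closure_cspan[of "T e ` B"] by blast
      have "closed (T e -` closure (cspan (T e ` B)))"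
        by (intro continuous_closed_vimage closed_closure) (auto intro!: continuous_intros)
      then show "closed ?V"
        by (simp add: vimage_def)
      note sub = subspace_closure_cspan[of "T e ` B"]
      show "complex_vector.subspace ?V"
        by (rule complex_vector.subspaceI)
           (simp_all add: blinfun.add_right hom_scaleC s_closed e complex_vector.subspace_0[OF sub]
             complex_vector.subspace_add[OF sub] complex_vector.subspace_scale[OF sub])
    qed
    moreover have "T' e u \<in> closure (cspan B)" if "T e (T' e u) = u" for u
    proof -
      have "P (rng G e) (T' e u) = T' e u"
        using T'_T[OF e, of "T' e u"] that by simp
      then show ?thesis
        using B vset_space_eq[OF vsets.range[OF e]] by (simp add: orthonormal_basis_def)
    qed
    ultimately show "edge_space A s \<pi> e \<subseteq> closure (cspan (T e ` B))"
      using e by (auto simp: edge_space_eq) (metis (mono_tags, lifting) mem_Collect_eq subsetD)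
  qed
  ultimately show ?thesis
    by (simp add: orthonormal_basis_def)
qed

text \<open>With the edge bases taken to be the images under \<open>T e\<close>, the second
  conclusion is exactly the required inclusion of edge bases in vertex bases.\<close>

theorem vertex_bases_exist:
  assumes wf: "wf (edge_rel G)"
    and sum: "\<And>e. e \<in> edges G \<Longrightarrow>
           hilbert_direct_sum (rng G e) (\<lambda>v. vset_space p \<pi> {v}) (vset_space p \<pi> (rng G e))"
  obtains BV where "\<And>v. v \<in> verts G \<Longrightarrow> orthonormal_basis (vset_space p \<pi> {v}) (BV v)"
    and "\<And>e. e \<in> edges G \<Longrightarrow> T e ` (\<Union>w\<in>rng G e. BV w) \<subseteq> BV (src G e)"
proof -
  \<comment> \<open>The parameter \<open>f\<close> stands for the bases chosen at smaller vertices;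
    keeping it free allows truncated functions in the recursion.\<close>
  define good where "good v f C \<longleftrightarrow> orthonormal_basis (vset_space p \<pi> {v}) C \<and>
      (\<forall>e\<in>edges G. src G e = v \<longrightarrow> T e ` (\<Union>w\<in>rng G e. f w) \<subseteq> C)" for v f C
  define BV where "BV = wfrec (edge_rel G) (\<lambda>f v. SOME C. good v f C)"
  \<comment> \<open>\<open>good v f\<close> consults \<open>f\<close> only at range vertices of
    edges leaving \<open>v\<close>, all below \<open>v\<close>. Truncation is thus invisible, and
    \<open>BV\<close> satisfies the recursion equation without \<open>cut\<close>.\<close>
  have good_cong: "good v (cut f (edge_rel G) v) = good v f" for v f
  proof -
    have "(\<Union>w\<in>rng G e. cut f (edge_rel G) v w) = (\<Union>w\<in>rng G e. f w)"
      if "e \<in> edges G" "src G e = v" for e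
      using that by (intro SUP_cong) (auto simp: cut_def edge_rel_def)
    then show ?thesis
      by (auto simp: good_def fun_eq_iff)
  qed
  have BV: "BV v = (SOME C. good v BV C)" for v
    using wfrec[OF wf, of "\<lambda>f v. SOME C. good v f C" v] by (simp add: good_cong flip: BV_def)
  have good_BV: "v \<in> verts G \<longrightarrow> good v BV (BV v)" for v
    using wf
  proof (induction v rule: wf_induct_rule)
    case (less v)
    show ?case
    proof
      assume v: "v \<in> verts G"
      let ?I = "{e\<in>edges G. src G e = v}"
      let ?E = "\<lambda>e. T e ` (\<Union>w\<in>rng G e. BV w)"
      have basis: "orthonormal_basis (edge_space A s \<pi> e) (?E e)" if "e \<in> ?I" for e
      proof (intro orthonormal_basis_image_T orthonormal_basis_UN[OF sum])
        fix w assume "w \<in> rng G e"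
        with that show "orthonormal_basis (vset_space p \<pi> {w}) (BV w)"
          using less[of w] rng_closed by (auto simp: edge_rel_def good_def)
      qed (use that in auto)
      have "orthonormal (\<Union>e\<in>?I. ?E e)"
      proof (rule orthonormal_UN)
        show "orthonormal (?E e)" "?E e \<subseteq> edge_space A s \<pi> e" if "e \<in> ?I" for e
          using basis[OF that] orthonormal_basis_subset by (auto simp: orthonormal_basis_iff)
        show "pairwise (\<lambda>e f. \<forall>x\<in>edge_space A s \<pi> e. \<forall>y\<in>edge_space A s \<pi> f. cinner x y = 0) ?I"
          by (auto simp: pairwise_def intro: edge_space_orthogonal)
      qed
      moreover have "(\<Union>e\<in>?I. ?E e) \<subseteq> vset_space p \<pi> {v}"
        using orthonormal_basis_subset[OF basis] edge_space_subset by (auto; blast)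
      ultimately obtain C where "orthonormal_basis (vset_space p \<pi> {v}) C" "(\<Union>e\<in>?I. ?E e) \<subseteq> C"
        using orthonormal_basis_extend[OF closed_vset_space[OF vsets.vertex[OF v]]
            subspace_vset_space[OF vsets.vertex[OF v]]] by blast
      \<comment> \<open>A witness is what makes the value picked by \<open>SOME\<close>
        meaningful.\<close>
      then have "good v BV C"
        by (auto simp: good_def)
      then have "good v BV (SOME C. good v BV C)"
        by (rule someI)
      then show "good v BV (BV v)"
        by (simp only: BV[symmetric])
    qed
  qed
  show ?thesis
  proof (rule that)
    show "orthonormal_basis (vset_space p \<pi> {v}) (BV v)" if "v \<in> verts G" for v
      using good_BV that by (auto simp: good_def)
    show "T e ` (\<Union>w\<in>rng G e. BV w) \<subseteq> BV (src G e)" if "e \<in> edges G" for e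
      using good_BV[of "src G e"] that src_closed[OF that] by (simp add: good_def)
  qed
qed

theorem permutative_if_wf:
  assumes wf: "wf (edge_rel G)"
    and sum: "\<And>e. e \<in> edges G \<Longrightarrow>
           hilbert_direct_sum (rng G e) (\<lambda>v. vset_space p \<pi> {v}) (vset_space p \<pi> (rng G e))"
  shows "permutative G A s p \<pi>"
proof -
  obtain BV where BV: "\<And>v. v \<in> verts G \<Longrightarrow> orthonormal_basis (vset_space p \<pi> {v}) (BV v)"
    and image: "\<And>e. e \<in> edges G \<Longrightarrow> T e ` (\<Union>w\<in>rng G e. BV w) \<subseteq> BV (src G e)"
    using vertex_bases_exist[OF wf sum] by blast
  have "orthonormal (\<Union>v\<in>verts G. BV v)"
  proof (rule orthonormal_UN)
    show "orthonormal (BV v)" "BV v \<subseteq> vset_space p \<pi> {v}" if "v \<in> verts G" for v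
      using BV[OF that] orthonormal_basis_subset by (auto simp: orthonormal_basis_iff)
    show "pairwise (\<lambda>v w. \<forall>x\<in>vset_space p \<pi> {v}. \<forall>y\<in>vset_space p \<pi> {w}. cinner x y = 0) (verts G)"
      unfolding pairwise_def
      by (intro ballI impI vset_space_orthogonal[of "{v}" "{w}" for v w]) (auto intro: vsets.vertex)
  qed
  \<comment> \<open>The vertex spaces need not span the Hilbert space, since the representation may
    be degenerate; the union of their bases is therefore extended.\<close>
  then obtain B where B: "orthonormal_basis UNIV B" "(\<Union>v\<in>verts G. BV v) \<subseteq> B"
    using orthonormal_basis_extend[of UNIV "\<Union>v\<in>verts G. BV v"] by auto
  \<comment> \<open>Depending on the set alone, this gives edges with equal ranges the same
    basis.\<close>
  define BR where "BR X = (\<Union>w\<in>X. BV w)" for X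
  have BR: "orthonormal_basis (vset_space p \<pi> (rng G e)) (BR (rng G e))" if "e \<in> edges G" for e
    unfolding BR_def using sum[OF that] by (rule orthonormal_basis_UN) (use BV rng_closed that in blast)
  show ?thesis
    unfolding permutative_def
  proof (intro exI conjI ballI)
    show "orthonormal_basis UNIV B" by fact
    show "orthonormal_basis (vset_space p \<pi> {v}) (BV v)" if "v \<in> verts G" for v
      using that by (rule BV)
    show "BV v \<subseteq> B" if "v \<in> verts G" for v
      using that B(2) by blast
    fix e assume e: "e \<in> edges G"
    show "orthonormal_basis (vset_space p \<pi> (rng G e)) (BR (rng G e))"
      using e by (rule BR)
    \<comment> \<open>The edge basis is chosen as the image of the range basis, so the last
      condition of permutativity holds by reflexivity.\<close>
    show "orthonormal_basis (edge_space A s \<pi> e) (T e ` BR (rng G e))"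
      using e BR by (intro orthonormal_basis_image_T)
    show "BR (rng G e) \<subseteq> B"
      unfolding BR_def using B(2) rng_closed[OF e] by blast
    show "BV v \<subseteq> BR (rng G e)" if "v \<in> rng G e" for v
      unfolding BR_def using that by blast
    show "T e ` BR (rng G e) = T e ` BR (rng G e)" ..
  next
    show "(\<Union>e\<in>{e\<in>edges G. src G e = v}. T e ` BR (rng G e)) \<subseteq> BV v" if "v \<in> verts G" for v
      using image unfolding BR_def by blast
  qed
qed

end

theorem theorem6p8:
  fixes G :: "('v, 'e) ugraph"
    and A :: "'a cstar"
    and s :: "'e \<Rightarrow> 'a"
    and p :: "'v set \<Rightarrow> 'a"
    and \<pi> :: "'a \<Rightarrow> ('h::chilbert_space \<Rightarrow>\<^sub>L 'h)"
  assumes "ultragraph G"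
    and "universal_ultragraph_algebra G A s p"
    and "separable_space (euclidean :: 'h topology)"
    and "\<not> (\<exists>S :: 'h set. finite S \<and> cspan S = UNIV)"
    and "\<pi> \<in> star_hom A bounded_operators"
    and "\<And>e. e \<in> edges G \<Longrightarrow>
           hilbert_direct_sum (rng G e) (\<lambda>v. vset_space p \<pi> {v}) (vset_space p \<pi> (rng G e))"
    and "\<exists>n\<ge>1. (\<forall>i\<in>{1..n}. stage_extreme G i \<noteq> {}) \<and>
           (\<Union>e\<in>edges G. rng G e) \<union> src G ` edges G =
             (\<Union>i\<in>{1..n}. \<Union>(stage_extreme G i) \<union> stage_isolated G i)"
  shows "permutative G A s p \<pi>"
proof -
  interpret ultragraph_representation G A s p \<pi>
    using assms(1,2,5) by (intro ultragraph_representation.intro ultragraph_representation_axioms.intro)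
      (simp_all add: universal_ultragraph_algebra_def)
  from assms(7) obtain n where "(\<Union>e\<in>edges G. rng G e) \<union> src G ` edges G =
      (\<Union>i\<in>{1..n}. \<Union>(stage_extreme G i) \<union> stage_isolated G i)"
    by (elim exE conjE)
  then have "wf (edge_rel G)"
    by (intro wf_edge_rel[of G n]) (metis Un_upper2)
  then show ?thesis
    using assms(6) by (rule permutative_if_wf)
qed

end
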